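(* Let $n\ge3$ be odd. For $0\le k<n$, $$\mathfrak{f}_{n,k}=(-1)^{k+1}\frac{2^{k+2}}{(k+2)!}\,\mathfrak{b}_{n,k+1}\qquad\text{and}\qquad\mathfrak{f}_{n-1,k}=(-1)^{k+1}\,\frac{3}{n}\,\frac{2^{k+1}}{(k+1)!}\,\mathfrak{b}_{n,k+1}.$$ Equivalently, in terms of derivatives, $$F_n^{(k)}(0)=(-1)^{k+1}\frac{2^{k+2}}{(k+1)(k+2)}\,\mathcal{B}_{n,2(k+1)}^{(k+1)}(1)\qquad\text{and}\qquad F_{n-1}^{(k)}(0)=(-1)^{k+1}\,\frac{3}{n}\,\frac{2^{k+1}}{k+1}\,\mathcal{B}_{n,2(k+1)}^{(k+1)}(1).$$ Furthermore, for every integer $n\ge2$ (of either parity), $(-1)^{\mathbf{d}_n-k}\,\mathfrak{f}_{n,k}>0$ for $0\le k\le\mathbf{d}_n$.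
   Context: Bernoulli polynomials: $\frac{te^{xt}}{e^t-1}=\sum_{n\ge0}\mathbf{B}_n(x)\frac{t^n}{n!}$, and $\mathbf{B}_n=\mathbf{B}_n(0)$. Generalized reciprocal Bernoulli polynomials: $\mathcal{B}_{n,k}(x)=x^k\,\mathbf{B}_n(x^{-1})$ for $n\ge0$, $k\in\mathbb{Z}$; $\mathcal{B}_{n,k}^{(\ell)}$ denotes the $\ell$-th derivative in $x$. Put $\mathfrak{b}_{n,k}=\mathcal{B}_{n,2k}^{(k)}(1)$ for $n\ge k\ge0$. Power sums: $S_n(x)=\frac{1}{n+1}(\mathbf{B}_{n+1}(x)-\mathbf{B}_{n+1})$, so that $S_n(m)=\sum_{\nu=0}^{m-1}\nu^n$; in particular $S_1(x)=\binom{x}{2}$. Faulhaber polynomials (classical Faulhaber–Jacobi theorem): for each $n\ge2$ there is a unique polynomial $F_n\in\mathbb{Q}[y]$, of degree $\mathbf{d}_n=\lfloor n/2\rfloor-1$, such that $S_n(x)=S_2(x)\,F_n(S_1(x))$ if $n$ is even and $S_n(x)=S_1(x)^2\,F_n(S_1(x))$ if $n$ is odd. Its coefficients are denoted $F_n(y)=\sum_{k\ge0}\mathfrak{f}_{n,k}\,y^k$, with $\mathfrak{f}_{n,k}=0$ for $k>\mathbf{d}_n$; $F_n^{(k)}$ is the $k$-th derivative in $y$. *)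

theory Defs
  imports "HOL-Analysis.Analysis" "HOL-Computational_Algebra.Computational_Algebra"
begin

text \<open>
  The Bernoulli polynomials, as polynomial functions: the quotient is that of formal power series
  in \<open>t\<close> (here \<^term>\<open>fps_X\<close>), for each fixed value of \<open>x\<close> in a field of characteristic 0.
  Numerator and denominator both have order 1 in \<open>t\<close>, so the quotient is exact.
\<close>

definition bernpoly :: "nat \<Rightarrow> 'a :: field_char_0 \<Rightarrow> 'a" where
  "bernpoly n x = fact n * fps_nth (fps_X * fps_exp x / (fps_exp 1 - 1)) n"

lemma bernpoly_generating_function:
  fixes x :: "'a :: field_char_0"
  shows "Abs_fps (\<lambda>n. bernpoly n x / fact n) * (fps_exp 1 - 1) = fps_X * fps_exp x"
proof -
  define g :: "'a fps" where "g = fps_exp 1 - 1"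
  have sg: "subdegree g = 1"
    by (rule subdegreeI) (auto simp: g_def)
  have "g dvd fps_X * fps_exp x"
    using sg by (subst fps_dvd_iff) (auto simp: g_def)
  moreover have "Abs_fps (\<lambda>n. bernpoly n x / fact n) = fps_X * fps_exp x / g"
    by (rule fps_ext) (simp add: bernpoly_def g_def)
  ultimately show ?thesis
    by (simp add: g_def)
qed

definition bernnum :: "nat \<Rightarrow> 'a :: field_char_0" where
  "bernnum n = bernpoly n 0"

definition recip_bernpoly :: "nat \<Rightarrow> int \<Rightarrow> real \<Rightarrow> real" where
  "recip_bernpoly n k x = x powi k * bernpoly n (inverse x)"

definition recip_bernpoly_deriv :: "nat \<Rightarrow> nat \<Rightarrow> int \<Rightarrow> real \<Rightarrow> real" where
  "recip_bernpoly_deriv l n k = (deriv ^^ l) (recip_bernpoly n k)"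

text \<open>The numbers \<open>\<bb>\<^sub>n\<^sub>,\<^sub>k\<close>; only used for \<open>k \<le> n\<close>.\<close>

definition bfrak :: "nat \<Rightarrow> nat \<Rightarrow> real" where
  "bfrak n k = recip_bernpoly_deriv k n (2 * int k) 1"

definition power_sum :: "nat \<Rightarrow> 'a :: field_char_0 \<Rightarrow> 'a" where
  "power_sum n x = 1 / of_nat (n + 1) * (bernpoly (n + 1) x - bernnum (n + 1))"

definition faulhaber_degree :: "nat \<Rightarrow> nat" where
  "faulhaber_degree n = n div 2 - 1"

text \<open>
  The Faulhaber polynomial \<open>F\<^sub>n\<close> for \<open>n \<ge> 2\<close>, unique by the Faulhaber--Jacobi theorem. Identities
  between polynomials over the rationals are stated as identities of functions on the rationals.
\<close>

definition faulhaber_poly :: "nat \<Rightarrow> rat poly" where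
  "faulhaber_poly n = (THE F. degree F = faulhaber_degree n \<and>
     (\<forall>x :: rat. power_sum n x =
        (if even n then power_sum 2 x * poly F (power_sum 1 x)
         else (power_sum 1 x)\<^sup>2 * poly F (power_sum 1 x))))"

definition faulhaber_coeff :: "nat \<Rightarrow> nat \<Rightarrow> rat" where
  "faulhaber_coeff n k = coeff (faulhaber_poly n) k"

end

theory Submission
  imports Defs
begin

text \<open>
  Write \<open>y = x (x - 1) / 2\<close>. By the symmetry \<open>x \<mapsto> 1 - x\<close> an even-indexed Bernoulli polynomial is
  \<open>A\<^sub>N(y)\<close> for a polynomial \<open>A\<^sub>N\<close>, and \<open>F\<^sub>n\<close> is read off from \<open>A\<^sub>n\<^sub>+\<^sub>1\<close> for odd \<open>n\<close> and
  from \<open>A\<^sub>n\<^sub>+\<^sub>2'\<close> for even \<open>n\<close>. Differentiating twice in \<open>x\<close>, where \<open>(y')\<^sup>2 = 2 y + 1 / 4\<close>,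
  gives a recurrence for the coefficients of \<open>A\<^sub>N\<close> from which the alternating signs follow by
  downward induction. For the values at 1, \<open>\<B>\<^sub>n\<^sub>,\<^sub>2\<^sub>m\<^sup>(\<^sup>m\<^sup>)(1) / m!\<close> is the coefficient of \<open>t\<^sup>m\<close> in
  \<open>(1 + t)\<^sup>2\<^sup>m B\<^sub>n(1 / (1 + t))\<close>. This functional sends \<open>(x - 1 / 2) y\<^sup>j\<close> to 0 unless \<open>j = m\<close>,
  because the two middle binomial coefficients of odd order coincide; hence it extracts a single
  coefficient of \<open>A\<^sub>n\<^sub>+\<^sub>1'\<close>.
\<close>

section \<open>Bernoulli polynomials\<close>

text \<open>Multiplied by e^t - 1, both sides become t e^(xt) by the generating functions at x and
  at 0; the nonzero factor e^t - 1 then cancels.\<close>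

lemma bernpoly_fps_mult_exp:
  fixes x :: "'a :: field_char_0"
  shows "Abs_fps (\<lambda>n. bernpoly n x / fact n) = fps_exp x * Abs_fps (\<lambda>n. bernnum n / fact n)"
proof -
  define E :: "'a fps" where "E = fps_exp 1 - 1"
  have "fps_nth E 1 \<noteq> 0"
    by (simp add: E_def)
  then have "E \<noteq> 0"
    by auto
  moreover have "Abs_fps (\<lambda>n. bernpoly n x / fact n) * E
      = (fps_exp x * Abs_fps (\<lambda>n. bernnum n / fact n)) * E"
    using bernpoly_generating_function[of x] bernpoly_generating_function[of "0 :: 'a"]
    by (simp add: E_def bernnum_def mult.assoc mult.commute mult.left_commute)
  ultimately show ?thesis
    by simp
qed

lemma bernpoly_altdef:
  "bernpoly n x = (\<Sum>i\<le>n. of_nat (n choose i) * bernnum (n - i) * x ^ i)"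
proof -
  have "bernpoly n x / fact n = (\<Sum>i\<le>n. x ^ i / fact i * (bernnum (n - i) / fact (n - i)))"
    using arg_cong[OF bernpoly_fps_mult_exp[of x], of "\<lambda>f. fps_nth f n"]
    by (simp add: fps_mult_nth atLeast0AtMost)
  then have "bernpoly n x
      = (\<Sum>i\<le>n. fact n * (x ^ i / fact i * (bernnum (n - i) / fact (n - i))))"
    by (simp add: field_simps sum_distrib_left)
  also have "\<dots> = (\<Sum>i\<le>n. of_nat (n choose i) * bernnum (n - i) * x ^ i)"
    by (intro sum.cong refl) (simp add: binomial_fact field_simps)
  finally show ?thesis .
qed

text \<open>The substitution t -> -t turns t e^(xt) / (e^t - 1) into t e^((1-x)t) / (e^t -
  1).\<close>

lemma bernpoly_reflect:
  fixes x :: "'a :: field_char_0"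
  shows "bernpoly n (1 - x) = (-1) ^ n * bernpoly n x"
proof -
  define E :: "'a fps" where "E = fps_exp 1 - 1"
  define G where "G = (\<lambda>x :: 'a. Abs_fps (\<lambda>n. bernpoly n x / fact n))"
  have G: "G z * E = fps_X * fps_exp z" for z
    using bernpoly_generating_function[of z] by (simp add: E_def G_def)
  \<comment> \<open>This is e^t (e^(-t) - 1) = -(e^t - 1), which brings the substituted denominator
    back to \<open>E\<close>.\<close>
  have exp_E: "fps_exp 1 * (E oo - fps_X) = - E"
    by (simp add: E_def fps_compose_sub_distrib right_diff_distrib fps_exp_add_mult [symmetric])
  have "(G x oo - fps_X) * (E oo - fps_X) = - fps_X * fps_exp (- x)"
    using arg_cong[OF G[of x], of "\<lambda>f. f oo - fps_X"]
    by (simp add: fps_compose_mult_distrib)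
  then have "(G x oo - fps_X) * (fps_exp 1 * (E oo - fps_X)) = - fps_X * (fps_exp 1 * fps_exp (- x))"
    by (metis mult.left_commute)
  then have "(G x oo - fps_X) * E = fps_X * fps_exp (1 - x)"
    by (simp add: exp_E fps_exp_add_mult [symmetric])
  also have "\<dots> = G (1 - x) * E"
    by (simp add: G)
  finally have "(G x oo - fps_X) * E = G (1 - x) * E" .
  moreover have "fps_nth E 1 \<noteq> 0"
    by (simp add: E_def)
  then have "E \<noteq> 0"
    by auto
  ultimately have "G x oo - fps_X = G (1 - x)"
    by simp
  from arg_cong[OF this, of "\<lambda>f. fps_nth f n"] show ?thesis
    by (simp add: G_def fps_compose_uminus')
qed

text \<open>The generating functions at 1 and 0 differ by exactly t, because t e^t - t = t (e^t -
  1).\<close>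

lemma bernpoly_1: "bernpoly n (1 :: 'a :: field_char_0) = bernnum n + of_bool (n = 1)"
proof -
  define E :: "'a fps" where "E = fps_exp 1 - 1"
  define G where "G = (\<lambda>x :: 'a. Abs_fps (\<lambda>n. bernpoly n x / fact n))"
  have G: "G z * E = fps_X * fps_exp z" for z
    using bernpoly_generating_function[of z] by (simp add: E_def G_def)
  have "G 1 * E = (G 0 + fps_X) * E"
    unfolding distrib_right G by (simp add: E_def algebra_simps)
  moreover have "fps_nth E 1 \<noteq> 0"
    by (simp add: E_def)
  then have "E \<noteq> 0"
    by auto
  ultimately have "G 1 = G 0 + fps_X"
    by simp
  from arg_cong[OF this, of "\<lambda>f. fps_nth f n"] show ?thesis
    by (auto simp: G_def bernnum_def field_simps)
qed

text \<open>Reflection at 0 gives B_n(1) = -B_n for odd n, while B_n(1) = B_n for n different from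
  1.\<close>

lemma bernnum_odd:
  assumes "odd n" "n \<noteq> 1"
  shows "bernnum n = (0 :: 'a :: field_char_0)"
  using bernpoly_reflect[of n "0 :: 'a"] bernpoly_1[of n, where 'a = 'a] assms
  by (simp add: bernnum_def)

text \<open>The expansion of B_(n+1)(1) in powers of 1, solved for its term with B_n. It yields the
  small values and the independence of the field.\<close>

lemma bernnum_rec:
  "bernnum n = (of_bool (n = 0)
     - (\<Sum>i<n. of_nat (Suc n choose Suc (Suc i)) * bernnum (n - Suc i))) / (of_nat n + 1 :: 'a :: field_char_0)"
proof -
  \<comment> \<open>The terms of index 0 and 1 are split off, so the remaining sum starts at index
    2.\<close>
  have "bernnum (Suc n) + (of_nat (Suc n) * bernnum n
          + (\<Sum>i<n. of_nat (Suc n choose Suc (Suc i)) * bernnum (n - Suc i)))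
        = bernpoly (Suc n) (1 :: 'a)"
    unfolding bernpoly_altdef sum.atMost_Suc_shift
    by (cases n) (simp_all add: sum.atMost_Suc_shift lessThan_Suc_atMost del: binomial_Suc_Suc sum.atMost_Suc sum.lessThan_Suc)
  then have "of_nat (Suc n) * bernnum n
          + (\<Sum>i<n. of_nat (Suc n choose Suc (Suc i)) * bernnum (n - Suc i))
      = (of_bool (n = 0) :: 'a)"
    by (simp add: bernpoly_1)
  moreover have "(of_nat n + 1 :: 'a) \<noteq> 0"
    using of_nat_neq_0[of n, where 'a = 'a] by (simp add: add.commute)
  ultimately show ?thesis
    by (simp add: field_simps)
qed

lemma bernnum_small:
  "bernnum 0 = (1 :: 'a :: field_char_0)"
  "bernnum 1 = (- 1 / 2 :: 'a)"
  "bernnum 2 = (1 / 6 :: 'a)"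
proof -
  show "bernnum 0 = (1 :: 'a)"
    by (subst bernnum_rec) simp
  then show "bernnum 1 = (- 1 / 2 :: 'a)"
    by (subst bernnum_rec) simp
  then show "bernnum 2 = (1 / 6 :: 'a)"
    using \<open>bernnum 0 = (1 :: 'a)\<close>
    by (subst bernnum_rec) (simp add: eval_nat_numeral)
qed

text \<open>The recurrence has rational coefficients. This links the rational Faulhaber coefficients
  to derivatives taken over the reals.\<close>

lemma of_rat_bernnum: "of_rat (bernnum n) = bernnum n"
proof (induction n rule: less_induct)
  case (less n)
  show ?case
    by (subst (1 2) bernnum_rec)
      (use less in \<open>simp add: of_rat_divide of_rat_diff of_rat_sum of_rat_mult of_rat_add
         del: binomial_Suc_Suc\<close>)
qed

lemma of_rat_bernpoly: "of_rat (bernpoly n x) = bernpoly n (of_rat x)"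
  by (simp add: bernpoly_altdef of_rat_sum of_rat_mult of_rat_power of_rat_bernnum)

section \<open>Bernoulli polynomials as elements of the polynomial ring\<close>

definition bernoulli_poly :: "nat \<Rightarrow> 'a :: field_char_0 poly" where
  "bernoulli_poly n = (\<Sum>i\<le>n. monom (of_nat (n choose i) * bernnum (n - i)) i)"

lemma coeff_bernoulli_poly: "coeff (bernoulli_poly n) i = of_nat (n choose i) * bernnum (n - i)"
  by (auto simp: bernoulli_poly_def coeff_sum sum.delta if_distrib binomial_eq_0 cong: if_cong)

lemma poly_bernoulli_poly [simp]: "poly (bernoulli_poly n) x = bernpoly n x"
  by (simp add: bernoulli_poly_def bernpoly_altdef poly_sum poly_monom)

lemma degree_bernoulli_poly [simp]: "degree (bernoulli_poly n) = n"
  by (intro antisym degree_le le_degree allI impI)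
    (simp_all add: coeff_bernoulli_poly binomial_eq_0 bernnum_small)

lemma lead_coeff_bernoulli_poly: "coeff (bernoulli_poly n) n = 1"
  by (simp add: coeff_bernoulli_poly bernnum_small)

lemma pderiv_bernoulli_poly:
  "pderiv (bernoulli_poly (Suc n)) = smult (of_nat (Suc n)) (bernoulli_poly n)"
proof (rule poly_eqI)
  fix i
  have "of_nat (Suc i) * of_nat (Suc n choose Suc i) = (of_nat (Suc n) * of_nat (n choose i) :: 'a)"
    unfolding of_nat_mult [symmetric] Suc_times_binomial_eq by (simp only: mult.commute)
  then show "coeff (pderiv (bernoulli_poly (Suc n))) i
      = (coeff (smult (of_nat (Suc n)) (bernoulli_poly n)) i :: 'a)"
    by (simp add: coeff_pderiv coeff_bernoulli_poly mult.assoc [symmetric] del: binomial_Suc_Suc of_nat_Suc)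
qed

lemma pcompose_reflect_bernoulli_poly:
  "pcompose (bernoulli_poly n) [:1, -1:] = smult ((-1) ^ n) (bernoulli_poly n :: 'a :: field_char_0 poly)"
  by (subst poly_eq_poly_eq_iff [symmetric])
    (simp add: fun_eq_iff poly_pcompose bernpoly_reflect)

section \<open>Even-indexed Bernoulli polynomials as polynomials in \<open>x (x - 1) / 2\<close>\<close>

text \<open>This is S_1, the argument of the Faulhaber polynomials. It is written y below.\<close>

definition choose2_poly :: "'a :: field_char_0 poly" where
  "choose2_poly = [:0, - (1 / 2), 1 / 2:]"

lemma poly_choose2_poly: "poly choose2_poly x = x * (x - 1) / 2"
  by (simp add: choose2_poly_def field_simps)

lemma degree_choose2_poly [simp]: "degree choose2_poly = 2"
  by (simp add: choose2_poly_def)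

text \<open>Composition with a nonconstant polynomial sends only 0 to 0.\<close>

lemma pcompose_choose2_poly_cancel:
  assumes "pcompose p choose2_poly = pcompose q (choose2_poly :: 'a :: field_char_0 poly)"
  shows "p = q"
  using pcompose_eq_0[of "p - q" choose2_poly] assms by (simp add: pcompose_diff)

text \<open>Induction on the degree: p - p(0) vanishes at 0 and, by invariance, at 1, so it is
  divisible by y. The quotient is again invariant and has smaller degree.\<close>

lemma reflect_invariant_poly:
  fixes p :: "'a :: field_char_0 poly"
  assumes "pcompose p [:1, -1:] = p"
  shows "\<exists>q. p = pcompose q choose2_poly"
  using assms
proof (induction "degree p" arbitrary: p rule: less_induct)
  case less
  show ?case
  proof (cases "degree p = 0")
    case True
    then obtain c where "p = [:c:]"
      by (rule degree_eq_zeroE)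
    then show ?thesis
      by (intro exI[of _ "[:c:]"]) simp
  next
    case False
    define r where "r = p - [:poly p 0:]"
    have r0: "poly r 0 = 0"
      by (simp add: r_def)
    have "poly p 1 = poly p 0"
      using arg_cong[OF less.prems, of "\<lambda>p. poly p 0"] by (simp add: poly_pcompose)
    then have r1: "poly r 1 = 0"
      by (simp add: r_def)
    obtain s where s: "r = [:0, 1:] * s"
      using r0 by (auto simp: poly_eq_0_iff_dvd)
    obtain t where t: "s = [:-1, 1:] * t"
      using r1 by (auto simp: s poly_eq_0_iff_dvd)
    have rt: "r = choose2_poly * smult 2 t"
      by (simp add: s t choose2_poly_def algebra_simps)
    have invar: "pcompose r [:1, -1:] = r"
      using less.prems by (simp add: r_def pcompose_diff)
    have "pcompose choose2_poly [:1, -1:] = (choose2_poly :: 'a poly)"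
      by (simp add: choose2_poly_def pcompose_pCons)
    then have "choose2_poly * pcompose (smult 2 t) [:1, -1:] = choose2_poly * smult 2 t"
      using invar by (simp add: rt pcompose_mult del: mult_smult_right)
    moreover have "choose2_poly \<noteq> (0 :: 'a poly)"
      by (simp add: choose2_poly_def)
    ultimately have sym: "pcompose (smult 2 t) [:1, -1:] = smult 2 t"
      by (simp del: mult_smult_right)
    have p: "p = [:poly p 0:] + choose2_poly * smult 2 t"
      using rt unfolding r_def by (metis add.commute diff_add_cancel)
    \<comment> \<open>A zero quotient would make p constant. For a nonzero one the degree drops by
      exactly 2, which the induction needs.\<close>
    have "t \<noteq> 0"
    proof
      assume "t = 0"
      with p have "p = [:poly p 0:]"
        by simp
      then have "degree p = degree [:poly p 0:]"
        by (rule arg_cong)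
      with False show False
        by simp
    qed
    then have "degree r = degree t + 2"
      unfolding rt by (subst degree_mult_eq) (auto simp: choose2_poly_def)
    moreover have "degree r = degree p"
      using False unfolding r_def diff_conv_add_uminus by (subst degree_add_eq_left) auto
    ultimately have "degree (smult 2 t) < degree p"
      by simp
    from less.hyps[OF this sym] obtain q where q: "smult 2 t = pcompose q choose2_poly" ..
    have "p = pcompose (pCons (poly p 0) q) choose2_poly"
      by (subst p) (simp only: q pcompose_pCons)
    then show ?thesis ..
  qed
qed

lemma even_bernoulli_poly_pcompose:
  "\<exists>A. pcompose A choose2_poly = (bernoulli_poly (2 * M) :: 'a :: field_char_0 poly)"
proof -
  have "pcompose (bernoulli_poly (2 * M)) [:1, -1:] = (bernoulli_poly (2 * M) :: 'a poly)"
    by (simp add: pcompose_reflect_bernoulli_poly)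
  then show ?thesis
    by (metis reflect_invariant_poly)
qed

section \<open>Differential equation, low and leading coefficients, and signs\<close>

lemma pderiv_choose2_poly: "pderiv choose2_poly = [:- (1 / 2), 1:]"
  by (simp add: choose2_poly_def pderiv_pCons)

text \<open>The second derivative of A(y) in x is A''(y) (y')^2 + A'(y) y'', where y'' = 1 and
  (y')^2 = (x - 1/2)^2 = 2y + 1/4. On the Bernoulli side, two derivatives lower the index by
  2.\<close>

lemma bernoulli_poly_pcompose_ode:
  fixes A C :: "'a :: field_char_0 poly"
  assumes A: "pcompose A choose2_poly = bernoulli_poly (Suc (Suc N))"
    and C: "pcompose C choose2_poly = bernoulli_poly N"
  shows "pderiv (pderiv A) * [:1 / 4, 2:] + pderiv A
    = smult (of_nat (Suc (Suc N)) * of_nat (Suc N)) C"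
proof (rule pcompose_choose2_poly_cancel)
  have deriv2: "pderiv [:- (1 / 2), 1 :: 'a:] = 1"
    by (simp add: pderiv_pCons)
  have square: "pcompose [:1 / 4, 2 :: 'a:] choose2_poly = [:- (1 / 2), 1:] * [:- (1 / 2), 1:]"
    by (simp add: choose2_poly_def pcompose_pCons)
  have "pderiv (pderiv (pcompose A choose2_poly))
      = pcompose (pderiv (pderiv A) * [:1 / 4, 2:] + pderiv A) choose2_poly"
    unfolding pderiv_pcompose pderiv_mult pderiv_choose2_poly pcompose_add pcompose_mult
    by (simp only: deriv2 square mult_1_left mult_1_right mult_ac add_ac)
  moreover have "pderiv (pderiv (pcompose A choose2_poly))
      = pcompose (smult (of_nat (Suc (Suc N)) * of_nat (Suc N)) C) choose2_poly"
    unfolding A pcompose_smult C pderiv_bernoulli_poly pderiv_smult smult_smult ..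
  ultimately show "pcompose (pderiv (pderiv A) * [:1 / 4, 2:] + pderiv A) choose2_poly
      = pcompose (smult (of_nat (Suc (Suc N)) * of_nat (Suc N)) C) choose2_poly"
    by simp
qed

lemma bernoulli_poly_pcompose_coeff_rec:
  fixes A C :: "'a :: field_char_0 poly"
  assumes "pcompose A choose2_poly = bernoulli_poly (Suc (Suc N))"
    and "pcompose C choose2_poly = bernoulli_poly N"
  shows "(of_nat j + 1) * (2 * of_nat j + 1) * coeff A (Suc j)
    + (of_nat j + 1) * (of_nat j + 2) / 4 * coeff A (Suc (Suc j))
    = (of_nat N + 2) * (of_nat N + 1) * coeff C j"
  using arg_cong[OF bernoulli_poly_pcompose_ode[OF assms], of "\<lambda>p. coeff p j"]
  by (cases j) (simp_all add: coeff_pderiv algebra_simps add_divide_distrib)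

lemma degree_bernoulli_poly_pcompose:
  assumes "pcompose A choose2_poly = (bernoulli_poly (2 * M) :: 'a :: field_char_0 poly)"
  shows "degree A = M"
  using arg_cong[OF assms, of degree] by (simp add: degree_pcompose)

lemma bernoulli_poly_pcompose_coeff_0:
  assumes "pcompose A choose2_poly = (bernoulli_poly (2 * M) :: 'a :: field_char_0 poly)"
  shows "coeff A 0 = bernnum (2 * M)"
  using arg_cong[OF assms, of "\<lambda>p. poly p 0"]
  by (simp add: poly_pcompose poly_choose2_poly bernnum_def flip: poly_0_coeff_0)

text \<open>Differentiating A(y) = B_(n+1) in x gives A'(y) y' = (n+1) B_n, with y' = x -
  1/2.\<close>

lemma odd_bernoulli_poly_pcompose:
  assumes "pcompose A choose2_poly = (bernoulli_poly (Suc n) :: 'a :: field_char_0 poly)"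
  shows "bernoulli_poly n = [:- (1 / 2), 1:] * pcompose (smult (1 / of_nat (Suc n)) (pderiv A)) choose2_poly"
proof -
  have "smult (of_nat (Suc n)) (bernoulli_poly n) = pcompose (pderiv A) choose2_poly * [:- (1 / 2), 1:]"
    using arg_cong[OF assms, of pderiv]
    by (simp only: pderiv_pcompose pderiv_bernoulli_poly pderiv_choose2_poly)
  then have "smult (1 / of_nat (Suc n)) (smult (of_nat (Suc n)) (bernoulli_poly n))
    = smult (1 / of_nat (Suc n)) (pcompose (pderiv A) choose2_poly * [:- (1 / 2), 1:])"
    by (rule arg_cong)
  then show ?thesis
    by (simp only: pcompose_smult mult_smult_left mult_smult_right smult_smult mult.commute)
      (simp del: of_nat_Suc)
qed

text \<open>At x = 0 the factor y' = x - 1/2 is nonzero but B_(2M-1) vanishes, so A'(0) = 0.\<close>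

lemma bernoulli_poly_pcompose_coeff_1:
  assumes "pcompose A choose2_poly = (bernoulli_poly (2 * M) :: 'a :: field_char_0 poly)" "M \<ge> 2"
  shows "coeff A 1 = 0"
proof -
  obtain n where n: "2 * M = Suc n" "odd n" "n \<noteq> 1"
    using assms(2) by (intro that[of "2 * M - 1"]) auto
  have "poly (bernoulli_poly n) 0 = (0 :: 'a)"
    using bernnum_odd[OF n(2,3)] by (simp add: bernnum_def)
  then have "poly (pderiv A) 0 = 0"
    using assms(1) unfolding n(1)
    by (subst (asm) odd_bernoulli_poly_pcompose)
      (simp_all add: poly_pcompose poly_choose2_poly del: of_nat_Suc)
  then show ?thesis
    by (simp add: poly_0_coeff_0 coeff_pderiv)
qed

text \<open>B_(2M) is monic and y^M has leading coefficient 2^(-M).\<close>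

lemma bernoulli_poly_pcompose_lead_coeff_pos:
  fixes A :: "'a :: linordered_field poly"
  assumes "pcompose A choose2_poly = bernoulli_poly (2 * M)"
  shows "coeff A M > 0"
proof -
  have lead: "coeff (choose2_poly :: 'a poly) 2 = 1 / 2"
    by (simp add: choose2_poly_def numeral_2_eq_2)
  have "lead_coeff (pcompose A choose2_poly) = 1"
    by (simp add: assms lead_coeff_bernoulli_poly)
  then have "coeff A M * (1 / 2) ^ M = 1"
    using degree_bernoulli_poly_pcompose[OF assms]
    by (subst (asm) lead_coeff_comp) (simp_all only: degree_choose2_poly lead)
  then show ?thesis
    by (metis zero_less_mult_pos2 zero_less_one zero_less_power half_gt_zero)
qed

text \<open>Induction on M and, inside it, downwards on j from the leading coefficient. The
  recurrence is solved for its lowest coefficient of A, and the two remaining terms turn out to have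
  the same sign.\<close>

lemma bernoulli_poly_pcompose_coeff_sign:
  fixes A :: "'a :: linordered_field poly"
  assumes "pcompose A choose2_poly = bernoulli_poly (2 * M)" "2 \<le> j" "j \<le> M"
  shows "(-1) ^ (M - j) * coeff A j > 0"
  using assms
proof (induction M arbitrary: A j)
  case 0
  then show ?case
    by simp
next
  case (Suc M)
  obtain C :: "'a poly" where C: "pcompose C choose2_poly = bernoulli_poly (2 * M)"
    using even_bernoulli_poly_pcompose by blast
  have A: "pcompose A choose2_poly = bernoulli_poly (Suc (Suc (2 * M)))"
    using Suc.prems by simp
  show ?case
    using Suc.prems(3)
  proof (induction rule: inc_induct)
    case base
    show ?case
      using bernoulli_poly_pcompose_lead_coeff_pos[OF Suc.prems(1)] by simp
  next
    case (step n)
    obtain i where i: "n = Suc i" "1 \<le> i" "i < M"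
      using step.hyps Suc.prems(2) by (cases n) auto
    \<comment> \<open>The common sign expected of \<open>coeff C i\<close>, of
      \<open>- coeff A (i + 2)\<close> and hence of \<open>coeff A (i + 1)\<close>.\<close>
    define s :: 'a where "s = (-1) ^ (M - i)"
    have distr: "K * (s * c) + L * (s * - a) = s * (K * c - L * a)" for K L c a :: 'a
      by (simp add: algebra_simps)
    \<comment> \<open>For i = 1 the outer induction hypothesis does not apply and the coefficient is
      0. Strictness therefore comes from the coefficient of A.\<close>
    have "0 \<le> s * coeff C i"
    proof (cases "i = 1")
      case True
      then show ?thesis
        using bernoulli_poly_pcompose_coeff_1[OF C] i by simp
    next
      case False
      then show ?thesis
        using Suc.IH[OF C, of i] i by (simp add: s_def)
    qed
    moreover have "0 < s * - coeff A (Suc n)"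
    proof -
      have "M - i = Suc (Suc M - Suc n)"
        using i by simp
      then show ?thesis
        using step.IH by (simp add: s_def)
    qed
    moreover have pos: "0 < (of_nat i + 1) * (of_nat i + c :: 'a)" if "c > 0" for c
      using that by (intro mult_pos_pos add_nonneg_pos) simp_all
    ultimately have "0 < (of_nat (2 * M) + 2) * (of_nat (2 * M) + 1) * (s * coeff C i)
        + (of_nat i + 1) * (of_nat i + 2) / 4 * (s * - coeff A (Suc n))"
      by (intro add_nonneg_pos mult_nonneg_nonneg[of "_ * _" "s * _"] mult_pos_pos[of "_ / 4" "s * _"]
          divide_pos_pos pos) simp_all
    also have "\<dots> = s * ((of_nat (2 * M) + 2) * (of_nat (2 * M) + 1) * coeff C i
        - (of_nat i + 1) * (of_nat i + 2) / 4 * coeff A (Suc n))"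
      by (rule distr)
    also have "\<dots> = s * ((of_nat i + 1) * (2 * of_nat i + 1) * coeff A n)"
      unfolding bernoulli_poly_pcompose_coeff_rec[OF A C, of i, symmetric] i by simp
    also have "\<dots> = ((of_nat i + 1) * (2 * of_nat i + 1)) * (s * coeff A n)"
      by simp
    finally have "0 < ((of_nat i + 1) * (2 * of_nat i + 1)) * (s * coeff A n)" .
    moreover have "0 < (of_nat i + 1) * (2 * of_nat i + 1 :: 'a)"
      by (intro mult_pos_pos add_nonneg_pos) simp_all
    ultimately have "0 < s * coeff A n"
      by (rule zero_less_mult_pos)
    then show ?case
      using i by (simp add: s_def)
  qed
qed

section \<open>Faulhaber polynomials\<close>

lemma power_sum_1: "power_sum 1 x = poly choose2_poly x"
proof -
  have "bernpoly 2 x - bernnum 2 = x ^ 2 - x"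
    using bernnum_small[where 'a = 'a]
    by (simp add: bernpoly_altdef eval_nat_numeral)
  then show ?thesis
    by (simp add: power_sum_def poly_choose2_poly algebra_simps power2_eq_square flip: numeral_2_eq_2)
qed

text \<open>The factor x - 1/2 is y', the same one that splits off from the odd-indexed Bernoulli
  polynomials.\<close>

lemma power_sum_2: "power_sum 2 x = 2 / 3 * (x - 1 / 2) * poly choose2_poly x"
proof -
  have "bernpoly 3 x - bernnum 3 = x ^ 3 - 3 / 2 * x ^ 2 + x / 2"
    by (simp add: bernpoly_altdef eval_nat_numeral bernnum_small(1) bernnum_small(2)[unfolded One_nat_def]
        bernnum_small(3)[unfolded numeral_2_eq_2])
  then have "power_sum 2 x = 1 / 3 * (x ^ 3 - 3 / 2 * x ^ 2 + x / 2)"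
    unfolding power_sum_def by simp
  also have "\<dots> = 2 / 3 * (x - 1 / 2) * poly choose2_poly x"
    by (simp add: poly_choose2_poly field_simps power2_eq_square power3_eq_cube)
  finally show ?thesis .
qed

text \<open>Uniqueness: the right-hand side is P(x) F(y) with a fixed nonzero polynomial P. Equality
  at all rationals is equality of polynomials, so P cancels, and then the composition with
  y.\<close>

lemma faulhaber_poly_eqI:
  assumes deg: "degree F = faulhaber_degree n"
    and F: "\<And>x. power_sum n x = (if even n then power_sum 2 x * poly F (power_sum 1 x)
         else (power_sum 1 x)\<^sup>2 * poly F (power_sum 1 x))"
  shows "faulhaber_poly n = F"
  unfolding faulhaber_poly_def
proof (rule the_equality)
  fix G
  assume G: "degree G = faulhaber_degree n \<and>
     (\<forall>x :: rat. power_sum n x = (if even n then power_sum 2 x * poly G (power_sum 1 x)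
         else (power_sum 1 x)\<^sup>2 * poly G (power_sum 1 x)))"
  \<comment> \<open>S_2 or S_1^2, according to the parity of n.\<close>
  define P :: "rat poly"
    where "P = (if even n then [:- (1 / 3), 2 / 3:] * choose2_poly else choose2_poly ^ 2)"
  have "P \<noteq> 0"
    by (simp add: P_def choose2_poly_def)
  have P: "(if even n then power_sum 2 x * poly H (power_sum 1 x)
      else (power_sum 1 x)\<^sup>2 * poly H (power_sum 1 x)) = poly (P * pcompose H choose2_poly) x" for H x
    unfolding P_def power_sum_1 power_sum_2 by (simp add: poly_pcompose field_simps)
  have "poly (P * pcompose (F - G) choose2_poly) x = 0" for x
  proof -
    have "poly (P * pcompose F choose2_poly) x = poly (P * pcompose G choose2_poly) x"
      using F[of x] G by (simp only: P)
    then show ?thesis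
      by (simp only: pcompose_diff right_diff_distrib poly_diff diff_self)
  qed
  then have "poly (P * pcompose (F - G) choose2_poly) x = poly 0 x" for x
    by simp
  then have "P * pcompose (F - G) choose2_poly = 0"
    using poly_eq_poly_eq_iff by blast
  with \<open>P \<noteq> 0\<close> have "pcompose (F - G) choose2_poly = 0"
    by simp
  then show "G = F"
    using pcompose_choose2_poly_cancel[of F G] by (simp add: pcompose_diff)
qed (use assms in blast)

lemma degree_poly_shift: "degree (poly_shift n p) = degree p - n"
proof (cases "degree p < n")
  case True
  then have "poly_shift n p = 0"
    by (intro poly_eqI) (simp add: coeff_poly_shift coeff_eq_0)
  with True show ?thesis
    by simp
next
  case False
  show ?thesis
  proof (cases "p = 0")
    case False
    with \<open>\<not> degree p < n\<close> show ?thesis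
      by (intro antisym degree_le le_degree allI impI)
        (auto simp: coeff_poly_shift coeff_eq_0)
  qed simp
qed

lemma pCons_poly_shift_Suc: "pCons (coeff p n) (poly_shift (Suc n) p) = poly_shift n p"
  by (rule poly_eqI) (simp add: coeff_poly_shift coeff_pCons split: nat.split)

text \<open>A has constant term B_(2m+2) and no linear term, so B_(2m+2)(x) - B_(2m+2) is y^2 times
  the shifted polynomial at y.\<close>

lemma faulhaber_poly_odd:
  assumes A: "pcompose A choose2_poly = bernoulli_poly (2 * m + 2)" and "m \<ge> 1"
  shows "faulhaber_poly (2 * m + 1) = smult (1 / of_nat (2 * m + 2)) (poly_shift 2 A)"
proof (rule faulhaber_poly_eqI)
  have A': "pcompose A choose2_poly = bernoulli_poly (2 * (m + 1))"
    using A by simp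
  show "degree (smult (1 / of_nat (2 * m + 2)) (poly_shift 2 A)) = faulhaber_degree (2 * m + 1)"
    using degree_bernoulli_poly_pcompose[OF A'] by (simp add: degree_poly_shift faulhaber_degree_def del: of_nat_Suc)
  fix x :: rat
  have "A = pCons (bernnum (2 * m + 2)) (pCons 0 (poly_shift 2 A))"
    using bernoulli_poly_pcompose_coeff_0[OF A'] bernoulli_poly_pcompose_coeff_1[OF A'] \<open>m \<ge> 1\<close>
      pCons_poly_shift_Suc[of A 0] pCons_poly_shift_Suc[of A 1]
    by (simp add: numeral_2_eq_2)
  from arg_cong[OF this, of "\<lambda>A. poly A (poly choose2_poly x)"]
  have "poly A (poly choose2_poly x) = bernnum (2 * m + 2)
      + (poly choose2_poly x)\<^sup>2 * poly (poly_shift 2 A) (poly choose2_poly x)"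
    by (simp only: poly_pCons power2_eq_square) (simp add: algebra_simps)
  moreover have "poly A (poly choose2_poly x) = bernpoly (2 * m + 2) x"
    using A by (simp flip: poly_pcompose)
  ultimately have "bernpoly (2 * m + 2) x = bernnum (2 * m + 2)
      + (poly choose2_poly x)\<^sup>2 * poly (poly_shift 2 A) (poly choose2_poly x)"
    by simp
  then show "power_sum (2 * m + 1) x = (if even (2 * m + 1)
      then power_sum 2 x * poly (smult (1 / of_nat (2 * m + 2)) (poly_shift 2 A)) (power_sum 1 x)
      else (power_sum 1 x)\<^sup>2 * poly (smult (1 / of_nat (2 * m + 2)) (poly_shift 2 A)) (power_sum 1 x))"
    unfolding power_sum_1 by (simp add: power_sum_def)
qed

text \<open>As B_(2m+1) = 0, the power sum is B_(2m+1)(x) / (2m+1), which is a multiple of (x - 1/2)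
  A'(y). Since A' has no constant term, one y splits off; the 3/2 in the constant compensates the
  2/3 in S_2.\<close>

lemma faulhaber_poly_even:
  assumes A: "pcompose A choose2_poly = bernoulli_poly (2 * m + 2)" and "m \<ge> 1"
  shows "faulhaber_poly (2 * m)
    = smult (3 / (2 * of_nat (2 * m + 1) * of_nat (2 * m + 2))) (poly_shift 1 (pderiv A))"
    (is "_ = smult ?c _")
proof (rule faulhaber_poly_eqI)
  have A': "pcompose A choose2_poly = bernoulli_poly (2 * (m + 1))"
    using A by simp
  have c: "?c \<noteq> 0"
    using of_nat_neq_0[of "2 * m", where 'a = rat] of_nat_neq_0[of "2 * m + 1", where 'a = rat]
    by (simp del: of_nat_Suc of_nat_add)
  show "degree (smult ?c (poly_shift 1 (pderiv A))) = faulhaber_degree (2 * m)"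
    unfolding degree_smult_eq using c degree_bernoulli_poly_pcompose[OF A']
    by (simp add: degree_poly_shift degree_pderiv faulhaber_degree_def)
  fix x :: rat
  have cancel: "1 / a * (z * (y * P / b)) = 2 / 3 * z * y * (3 / (2 * a * b) * P)"
    for a b z y P :: rat
    by simp
  have "pderiv A = pCons 0 (poly_shift 1 (pderiv A))"
    using bernoulli_poly_pcompose_coeff_1[OF A'] \<open>m \<ge> 1\<close> pCons_poly_shift_Suc[of "pderiv A" 0]
    by (simp add: coeff_pderiv)
  from arg_cong[OF this, of "\<lambda>A. poly A (poly choose2_poly x)"]
  have "poly (pderiv A) (poly choose2_poly x)
      = poly choose2_poly x * poly (poly_shift 1 (pderiv A)) (poly choose2_poly x)"
    by simp
  moreover have "bernpoly (2 * m + 1) x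
      = (x - 1 / 2) * (poly (pderiv A) (poly choose2_poly x) / of_nat (2 * m + 2))"
    using arg_cong[OF odd_bernoulli_poly_pcompose[of A "2 * m + 1"], of "\<lambda>p. poly p x"] A
    by (simp add: poly_pcompose algebra_simps diff_divide_distrib del: of_nat_Suc of_nat_add)
  moreover have "bernnum (2 * m + 1) = (0 :: rat)"
    using \<open>m \<ge> 1\<close> by (intro bernnum_odd) simp_all
  ultimately have "power_sum (2 * m) x = 1 / of_nat (2 * m + 1) * ((x - 1 / 2) * (poly choose2_poly x
      * poly (poly_shift 1 (pderiv A)) (poly choose2_poly x) / of_nat (2 * m + 2)))"
    unfolding power_sum_def by simp
  also have "\<dots> = power_sum 2 x * poly (smult ?c (poly_shift 1 (pderiv A))) (power_sum 1 x)"
    unfolding power_sum_1 power_sum_2 poly_smult by (rule cancel)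
  finally show "power_sum (2 * m) x = (if even (2 * m)
      then power_sum 2 x * poly (smult ?c (poly_shift 1 (pderiv A))) (power_sum 1 x)
      else (power_sum 1 x)\<^sup>2 * poly (smult ?c (poly_shift 1 (pderiv A))) (power_sum 1 x))"
    by simp
qed

lemma faulhaber_coeff_odd:
  assumes "pcompose A choose2_poly = bernoulli_poly (2 * m + 2)" "m \<ge> 1"
  shows "faulhaber_coeff (2 * m + 1) k = coeff A (k + 2) / of_nat (2 * m + 2)"
  unfolding faulhaber_coeff_def faulhaber_poly_odd[OF assms] by (simp add: coeff_poly_shift)

text \<open>Grouped so that the last factor is the coefficient for the odd index 2m + 1.\<close>

lemma faulhaber_coeff_even:
  assumes "pcompose A choose2_poly = bernoulli_poly (2 * m + 2)" "m \<ge> 1"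
  shows "faulhaber_coeff (2 * m) k
    = 3 * of_nat (k + 2) / (2 * of_nat (2 * m + 1)) * (coeff A (k + 2) / of_nat (2 * m + 2))"
  unfolding faulhaber_coeff_def faulhaber_poly_even[OF assms] by (simp add: coeff_poly_shift coeff_pderiv)

text \<open>With m = n div 2, both parities give a positive multiple of the coefficient of y^(k+2)
  in the polynomial for B_(2m+2).\<close>

lemma faulhaber_coeff_sign:
  assumes "n \<ge> 2" "k \<le> faulhaber_degree n"
  shows "(-1) ^ (faulhaber_degree n - k) * faulhaber_coeff n k > 0"
proof -
  define m where "m = n div 2"
  have m: "m \<ge> 1" "faulhaber_degree n = m - 1"
    using assms(1) by (simp_all add: m_def faulhaber_degree_def)
  obtain A :: "rat poly" where "pcompose A choose2_poly = bernoulli_poly (2 * (m + 1))"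
    using even_bernoulli_poly_pcompose by blast
  then have A: "pcompose A choose2_poly = bernoulli_poly (2 * m + 2)" "m \<ge> 1"
    using m by simp_all
  have "m + 1 - (k + 2) = faulhaber_degree n - k"
    using m by simp
  then have sign: "(-1) ^ (faulhaber_degree n - k) * coeff A (k + 2) > 0"
    using bernoulli_poly_pcompose_coeff_sign[of A "m + 1" "k + 2"] A assms(2) m by simp
  have "\<exists>c > 0. faulhaber_coeff n k = c * coeff A (k + 2)"
  proof (cases "even n")
    case True
    then have "n = 2 * m"
      by (simp add: m_def)
    then show ?thesis
      using faulhaber_coeff_even[OF A, of k]
      by (intro exI[of _ "3 * of_nat (k + 2) / (2 * of_nat (2 * m + 1)) / of_nat (2 * m + 2)"])
        (simp del: of_nat_Suc of_nat_add)
  next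
    case False
    then have "n = 2 * m + 1"
      unfolding m_def by presburger
    then show ?thesis
      using faulhaber_coeff_odd[OF A, of k]
      by (intro exI[of _ "1 / of_nat (2 * m + 2)"]) (simp del: of_nat_Suc of_nat_add)
  qed
  then obtain c where "c > 0" "faulhaber_coeff n k = c * coeff A (k + 2)"
    by blast
  then show ?thesis
    using mult_pos_pos[OF \<open>c > 0\<close> sign] by (simp add: mult.left_commute)
qed

section \<open>Reciprocal Bernoulli polynomials\<close>

text \<open>On the positive axis the function is a combination of powers x^(k-i), and the l-th
  derivative of x^a is l! binom(a, l) x^(a-l).\<close>

lemma higher_deriv_recip_bernpoly:
  assumes "x > 0"
  shows "recip_bernpoly_deriv l n k x = (\<Sum>i\<le>n. coeff (bernoulli_poly n) i
    * (fact l * (of_int (k - int i) gchoose l)) * x powi (k - int i - int l))"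
  using assms
proof (induction l arbitrary: x)
  case 0
  have "x powi k * inverse x ^ i = x powi (k - int i)" for i
    using 0 by (simp add: power_int_diff field_simps)
  note this [symmetric, simp]
  show ?case
    by (simp add: recip_bernpoly_deriv_def recip_bernpoly_def bernpoly_altdef coeff_bernoulli_poly
        sum_distrib_left mult_ac)
next
  case (Suc l)
  define c where "c = (\<lambda>i. coeff (bernoulli_poly n) i * (fact l * (of_int (k - int i) gchoose l)) :: real)"
  \<comment> \<open>The induction hypothesis is available only for positive arguments; agreement
    near x suffices for the derivative.\<close>
  have ev: "eventually (\<lambda>x. recip_bernpoly_deriv l n k x
      = (\<Sum>i\<le>n. c i * x powi (k - int i - int l))) (nhds x)"
    using eventually_nhds_in_open[of "{0<..}" x] Suc
    by (auto simp: c_def elim!: eventually_mono)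
  have "((\<lambda>x. \<Sum>i\<le>n. c i * x powi (k - int i - int l)) has_field_derivative
      (\<Sum>i\<le>n. c i * (of_int (k - int i - int l) * x powi (k - int i - int l - 1)))) (at x)"
    using Suc.prems by (auto intro!: derivative_eq_intros simp: mult_ac)
  then have "deriv (recip_bernpoly_deriv l n k) x
      = (\<Sum>i\<le>n. c i * (of_int (k - int i - int l) * x powi (k - int i - int l - 1)))"
    unfolding deriv_cong_ev[OF ev refl] by (rule DERIV_imp_deriv)
  also have "\<dots> = (\<Sum>i\<le>n. coeff (bernoulli_poly n) i
    * (fact (Suc l) * (of_int (k - int i) gchoose Suc l)) * x powi (k - int i - int (Suc l)))"
    unfolding c_def gbinomial_mult_fact
    by (intro sum.cong refl) (simp add: algebra_simps)
  finally show ?case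
    by (simp add: recip_bernpoly_deriv_def)
qed

section \<open>Evaluation of polynomials at 1/(1+t) and coefficient extraction\<close>

definition poly_eval_fps :: "'a :: field_char_0 fps \<Rightarrow> 'a poly \<Rightarrow> 'a fps" where
  "poly_eval_fps q p = poly (map_poly fps_const p) q"

lemma poly_eval_fps_0 [simp]: "poly_eval_fps q 0 = 0"
  by (simp add: poly_eval_fps_def)

lemma poly_eval_fps_pCons [simp]:
  "poly_eval_fps q (pCons a p) = fps_const a + q * poly_eval_fps q p"
  by (simp add: poly_eval_fps_def map_poly_pCons)

lemma poly_eval_fps_add: "poly_eval_fps q (p + r) = poly_eval_fps q p + poly_eval_fps q r"
  by (induction p r rule: poly_induct2) (simp_all add: algebra_simps flip: fps_const_add)

lemma poly_eval_fps_smult: "poly_eval_fps q (smult c p) = fps_const c * poly_eval_fps q p"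
  by (induction p) (simp_all add: algebra_simps flip: fps_const_mult)

lemma poly_eval_fps_mult: "poly_eval_fps q (p * r) = poly_eval_fps q p * poly_eval_fps q r"
  by (induction p) (simp_all add: algebra_simps poly_eval_fps_add poly_eval_fps_smult)

lemma poly_eval_fps_pcompose:
  "poly_eval_fps q (pcompose p r) = poly_eval_fps (poly_eval_fps q r) p"
  by (induction p) (simp_all add: pcompose_pCons poly_eval_fps_add poly_eval_fps_mult)

lemma poly_eval_fps_altdef:
  "poly_eval_fps q p = (\<Sum>i\<le>degree p. fps_const (coeff p i) * q ^ i)"
  by (simp add: poly_eval_fps_def poly_altdef coeff_map_poly degree_map_poly)

text \<open>binom(a-i, m) is the coefficient of t^m in (1+t)^a (1+t)^(-i), so the sum is read off
  from (1+t)^a p(1/(1+t)).\<close>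

lemma sum_coeff_gbinomial_conv_fps_nth:
  "(\<Sum>i\<le>degree p. coeff p i * ((a - of_nat i) gchoose m))
    = fps_nth (fps_binomial a * poly_eval_fps (fps_binomial (-1)) p) m"
proof -
  have "fps_binomial a * (fps_const c * fps_binomial (- 1) ^ i)
      = fps_const c * fps_binomial (a - of_nat i)" for c and i
    by (simp add: fps_binomial_power mult.left_commute flip: fps_binomial_add_mult)
  then show ?thesis
    unfolding poly_eval_fps_altdef sum_distrib_left fps_sum_nth by (simp only: fps_mult_left_const_nth fps_binomial_nth)
qed

text \<open>For j < m, with p = m - j - 1, the coefficient is binom(2p+1, p+1) - binom(2p+1, p) = 0.
  For j = m it is a constant term, and for j > m the factor t^j kills it.\<close>

lemma fps_nth_binomial_symmetric:
  "fps_nth (fps_binomial (2 * of_nat m - 1 - 2 * of_nat j) * (1 - fps_X) * fps_X ^ j) m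
    = (of_bool (j = m) :: 'a :: field_char_0)"
proof (cases "j < m")
  case True
  then obtain p where m: "m = j + Suc p"
    using less_imp_Suc_add by auto
  have "(2 * of_nat m - 1 - 2 * of_nat j :: 'a) = of_nat (2 * p + 1)"
    by (simp add: m)
  moreover have "2 * p + 1 choose Suc p = (2 * p + 1 choose p)"
    using binomial_symmetric[of p "2 * p + 1"] by simp
  ultimately show ?thesis
    using True
    by (simp add: m fps_X_power_mult_right_nth right_diff_distrib binomial_gbinomial [symmetric]
        del: of_nat_add of_nat_mult of_nat_Suc)
next
  case False
  then show ?thesis
    by (auto simp: fps_X_power_mult_right_nth fps_mult_nth_0)
qed

text \<open>Put Q = 1/(1+t). Substituting Q for x sends x - 1/2 to Q(1-t)/2 and y to -t Q^2/2, so
  the j-th term of D contributes a constant times (1+t)^(2m-1-2j) (1-t) t^j. Only j = m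
  survives.\<close>

lemma sum_coeff_gbinomial_pcompose_choose2:
  assumes p: "p = [:- (1 / 2), 1:] * pcompose D choose2_poly"
  shows "(\<Sum>i\<le>degree p. coeff p i * ((2 * of_nat m - of_nat i) gchoose m))
    = 1 / 2 * (- (1 / 2)) ^ m * (coeff D m :: 'a :: field_char_0)"
proof -
  define Q :: "'a fps" where "Q = fps_binomial (-1)"
  have Q: "(1 + fps_X) * Q = 1"
    unfolding Q_def fps_binomial_1 [symmetric] by (simp flip: fps_binomial_add_mult)
  then have Q': "Q = 1 - fps_X * Q"
    by (simp add: algebra_simps)
  have half: "fps_const (1 / 2) * 2 = (1 :: 'a fps)"
    by (simp add: numeral_fps_const)
  have "poly_eval_fps Q choose2_poly = fps_const (1 / 2) * (Q * (Q - 1))"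
    by (simp add: choose2_poly_def algebra_simps flip: fps_const_neg)
  also have "Q - 1 = - fps_X * Q"
    using Q' by (simp add: algebra_simps)
  finally have Y: "poly_eval_fps Q choose2_poly = fps_const (- (1 / 2)) * (fps_X * Q ^ 2)"
    by (simp add: power2_eq_square algebra_simps flip: fps_const_neg)
  \<comment> \<open>The constant 1/2 is written as (1+t) Q / 2, so that Q can be factored
    out.\<close>
  have "poly_eval_fps Q [:- (1 / 2), 1:] = Q - fps_const (1 / 2) * ((1 + fps_X) * Q)"
    unfolding Q by (simp flip: fps_const_neg)
  also have "\<dots> = fps_const (1 / 2) * (Q * (1 - fps_X)) + (1 - fps_const (1 / 2) * 2) * Q"
    by (simp add: algebra_simps)
  finally have H: "poly_eval_fps Q [:- (1 / 2), 1:] = fps_const (1 / 2) * (Q * (1 - fps_X))"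
    unfolding half by simp
  have nth_term: "fps_nth (fps_binomial (2 * of_nat m) * (fps_const (1 / 2) * (Q * (1 - fps_X))
      * (fps_const (coeff D j) * (fps_const (- (1 / 2)) * (fps_X * Q ^ 2)) ^ j))) m
    = 1 / 2 * coeff D j * (- (1 / 2)) ^ j * of_bool (j = m)" for j
  proof -
    have exponent: "fps_binomial (2 * of_nat m) * Q * (Q ^ 2) ^ j = fps_binomial (2 * of_nat m - 1 - 2 * of_nat j)"
      by (simp add: Q_def fps_binomial_power mult.commute[of _ 2] flip: fps_binomial_add_mult power_mult)
    have factors: "fps_binomial (2 * of_nat m) * (fps_const (1 / 2) * (Q * (1 - fps_X))
        * (fps_const (coeff D j) * (fps_const (- (1 / 2)) * (fps_X * Q ^ 2)) ^ j))
      = fps_const (1 / 2 * coeff D j * (- (1 / 2)) ^ j)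
        * ((fps_binomial (2 * of_nat m) * Q * (Q ^ 2) ^ j) * (1 - fps_X) * fps_X ^ j)"
      unfolding power_mult_distrib fps_const_power
      by (simp only: fps_const_mult [symmetric] mult_ac)
    show ?thesis
      unfolding factors exponent fps_mult_left_const_nth fps_nth_binomial_symmetric ..
  qed
  have "(\<Sum>i\<le>degree p. coeff p i * ((2 * of_nat m - of_nat i) gchoose m))
      = fps_nth (fps_binomial (2 * of_nat m) * (fps_const (1 / 2) * (Q * (1 - fps_X))
        * (\<Sum>j\<le>degree D. fps_const (coeff D j) * (fps_const (- (1 / 2)) * (fps_X * Q ^ 2)) ^ j))) m"
    unfolding sum_coeff_gbinomial_conv_fps_nth Q_def [symmetric]
    by (simp only: p poly_eval_fps_mult poly_eval_fps_pcompose H Y poly_eval_fps_altdef[of _ D])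
  also have "\<dots> = (\<Sum>j\<le>degree D. 1 / 2 * coeff D j * (- (1 / 2)) ^ j * of_bool (j = m))"
    unfolding sum_distrib_left fps_sum_nth nth_term ..
  also have "\<dots> = 1 / 2 * (- (1 / 2)) ^ m * coeff D m"
    by (auto simp: of_bool_def if_distrib sum.delta coeff_eq_0 cong: if_cong)
  finally show ?thesis .
qed

section \<open>The coefficient formulas\<close>

lemma poly_map_poly_of_rat:
  "poly (map_poly of_rat p) (of_rat x) = (of_rat (poly p x) :: 'a :: field_char_0)"
  by (induction p) (simp_all add: map_poly_pCons of_rat_add of_rat_mult)

text \<open>The two polynomials agree at the infinitely many images of rationals.\<close>

lemma pcompose_choose2_map_poly_of_rat:
  assumes "pcompose A choose2_poly = bernoulli_poly n"
  shows "pcompose (map_poly of_rat A) choose2_poly = (bernoulli_poly n :: 'a :: field_char_0 poly)"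
proof -
  let ?P = "pcompose (map_poly of_rat A) choose2_poly - (bernoulli_poly n :: 'a poly)"
  have "poly ?P (of_rat x) = 0" for x
  proof -
    have "poly choose2_poly (of_rat x) = (of_rat (poly choose2_poly x) :: 'a)"
      by (simp add: poly_choose2_poly of_rat_divide of_rat_mult of_rat_diff)
    moreover have "poly A (poly choose2_poly x) = bernpoly n x"
      using assms by (simp flip: poly_pcompose)
    ultimately show ?thesis
      by (simp add: poly_pcompose poly_map_poly_of_rat of_rat_bernpoly)
  qed
  then have "range of_rat \<subseteq> {x. poly ?P x = 0}"
    by auto
  moreover have "infinite (range (of_rat :: rat \<Rightarrow> 'a))"
    using finite_imageD[of "of_rat :: rat \<Rightarrow> 'a" UNIV] infinite_UNIV_char_0[where 'a = rat]
    by (auto simp: inj_on_def)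
  ultimately have "?P = 0"
    by (metis poly_roots_finite finite_subset)
  then show ?thesis
    by simp
qed

text \<open>At x = 1 the derivative is (k+1)! times the binomial functional with m replaced by k +
  1. That extracts \<open>coeff D (k + 1)\<close>, which is k + 2 times the Faulhaber coefficient;
  the k + 2 completes the factorial.\<close>

lemma bfrak_odd:
  assumes "m \<ge> 1"
  shows "bfrak (2 * m + 1) (k + 1)
    = (-1) ^ (k + 1) * (fact (k + 2) / 2 ^ (k + 2)) * of_rat (faulhaber_coeff (2 * m + 1) k)"
proof -
  obtain A :: "rat poly" where A': "pcompose A choose2_poly = bernoulli_poly (2 * (m + 1))"
    using even_bernoulli_poly_pcompose by blast
  then have A: "pcompose A choose2_poly = bernoulli_poly (2 * m + 2)"
    by simp
  define D :: "real poly" where "D = smult (1 / of_nat (Suc (2 * m + 1))) (pderiv (map_poly of_rat A))"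
  define p :: "real poly" where "p = bernoulli_poly (2 * m + 1)"
  have "pcompose (map_poly of_rat A) choose2_poly = (bernoulli_poly (Suc (2 * m + 1)) :: real poly)"
    using pcompose_choose2_map_poly_of_rat[OF A] by simp
  then have p: "p = [:- (1 / 2), 1:] * pcompose D choose2_poly"
    unfolding D_def p_def by (rule odd_bernoulli_poly_pcompose)
  have "bfrak (2 * m + 1) (k + 1)
      = fact (k + 1) * (\<Sum>i\<le>degree p. coeff p i * ((2 * of_nat (k + 1) - of_nat i) gchoose (k + 1)))"
    unfolding bfrak_def
    by (subst higher_deriv_recip_bernpoly)
      (simp_all add: p_def sum_distrib_left mult.left_commute del: fact_Suc of_nat_Suc of_nat_add sum.atMost_Suc)
  also have "\<dots> = fact (k + 1) * (1 / 2 * (- (1 / 2)) ^ (k + 1) * coeff D (k + 1))"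
    unfolding sum_coeff_gbinomial_pcompose_choose2[OF p] ..
  also have "coeff D (k + 1) = of_nat (k + 2) * of_rat (faulhaber_coeff (2 * m + 1) k)"
    unfolding faulhaber_coeff_odd[OF A assms]
    by (simp add: D_def coeff_pderiv coeff_map_poly of_rat_divide of_rat_add of_rat_mult)
  also have "fact (k + 1) * (1 / 2 * (- (1 / 2)) ^ (k + 1) * (of_nat (k + 2) * c))
      = (-1) ^ (k + 1) * (fact (k + 2) / 2 ^ (k + 2)) * c" for c :: real
    by (simp add: power_divide power_minus[of "1 / 2"] field_simps)
  finally show ?thesis .
qed

lemma faulhaber_coeff_even_odd:
  assumes "m \<ge> 1"
  shows "faulhaber_coeff (2 * m) k
    = 3 * of_nat (k + 2) / (2 * of_nat (2 * m + 1)) * faulhaber_coeff (2 * m + 1) k"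
proof -
  obtain A :: "rat poly" where A': "pcompose A choose2_poly = bernoulli_poly (2 * (m + 1))"
    using even_bernoulli_poly_pcompose by blast
  then have A: "pcompose A choose2_poly = bernoulli_poly (2 * m + 2)"
    by simp
  show ?thesis
    unfolding faulhaber_coeff_odd[OF A assms] faulhaber_coeff_even[OF A assms] ..
qed

lemma poly_higher_pderiv_0: "poly ((pderiv ^^ k) p) 0 = fact k * coeff p k"
  by (simp add: poly_0_coeff_0 coeff_higher_pderiv pochhammer_fact)

theorem corollary5p8:
  shows
    "(\<forall>n k :: nat. odd n \<and> n \<ge> 3 \<and> k < n \<longrightarrow>
        of_rat (faulhaber_coeff n k) =
          (-1) ^ (k + 1) * (2 ^ (k + 2) / fact (k + 2)) * bfrak n (k + 1) \<and>
        of_rat (faulhaber_coeff (n - 1) k) =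
          (-1) ^ (k + 1) * (3 / real n) * (2 ^ (k + 1) / fact (k + 1)) * bfrak n (k + 1) \<and>
        of_rat (poly ((pderiv ^^ k) (faulhaber_poly n)) 0) =
          (-1) ^ (k + 1) * (2 ^ (k + 2) / (real (k + 1) * real (k + 2))) *
            recip_bernpoly_deriv (k + 1) n (2 * (int k + 1)) 1 \<and>
        of_rat (poly ((pderiv ^^ k) (faulhaber_poly (n - 1))) 0) =
          (-1) ^ (k + 1) * (3 / real n) * (2 ^ (k + 1) / real (k + 1)) *
            recip_bernpoly_deriv (k + 1) n (2 * (int k + 1)) 1) \<and>
     (\<forall>n k :: nat. n \<ge> 2 \<and> k \<le> faulhaber_degree n \<longrightarrow>
        (-1) ^ (faulhaber_degree n - k) * faulhaber_coeff n k > 0)"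
proof (intro conjI allI impI)
  fix n k :: nat
  assume "odd n \<and> n \<ge> 3 \<and> k < n"
  then obtain m where m: "m \<ge> 1" "n = 2 * m + 1"
    by (auto elim!: oddE)
  define f :: real where "f = of_rat (faulhaber_coeff n k)"
  have b: "bfrak n (k + 1) = (-1) ^ (k + 1) * (fact (k + 2) / 2 ^ (k + 2)) * f"
    unfolding m(2) f_def by (rule bfrak_odd[OF m(1)])
  have bd: "recip_bernpoly_deriv (k + 1) n (2 * (int k + 1)) 1 = bfrak n (k + 1)"
    by (simp add: bfrak_def add.commute)
  have "of_rat (faulhaber_coeff (n - 1) k) = 3 * real (k + 2) / (2 * real n) * f"
    using faulhaber_coeff_even_odd[OF m(1), of k]
    by (simp add: f_def m(2) of_rat_divide of_rat_mult of_rat_add)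
  also have "\<dots> = (-1) ^ (k + 1) * (3 / real n) * (2 ^ (k + 1) / fact (k + 1)) * bfrak n (k + 1)"
  proof -
    \<comment> \<open>Used with r = k + 2, N = n, P = 2^(k+1), F = (k+1)! and s = (-1)^(k+1); the
      two signs cancel.\<close>
    have cancel: "3 * r / (2 * N) * f = s * (3 / N) * (P / F) * (s * (r * F / (2 * P)) * f)"
      if "s * s = 1" "F \<noteq> 0" "P \<noteq> 0" for r N F P s :: real
    proof -
      have "s * (3 / N) * (P / F) * (s * (r * F / (2 * P)) * f) = (s * s) * (3 * r / (2 * N) * f)"
        using that(2,3) by (simp add: mult_ac)
      then show ?thesis
        by (simp add: that(1))
    qed
    have "fact (k + 2) = real (k + 2) * fact (k + 1)" "(2 :: real) ^ (k + 2) = 2 * 2 ^ (k + 1)"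
      by simp_all
    then show ?thesis
      unfolding b by (simp only:) (rule cancel, simp_all)
  qed
  finally show even: "of_rat (faulhaber_coeff (n - 1) k) = \<dots>" .
  show odd: "of_rat (faulhaber_coeff n k)
      = (-1) ^ (k + 1) * (2 ^ (k + 2) / fact (k + 2)) * bfrak n (k + 1)"
    unfolding b f_def by (simp add: mult_ac del: fact_Suc power_Suc)
  \<comment> \<open>The k-th derivative at 0 is k! times the coefficient; this k! reduces the
    factorials in the denominators to k + 1 and (k+1)(k+2).\<close>
  have fact: "fact (k + 1) = real (k + 1) * fact k" "fact (k + 2) = real (k + 1) * real (k + 2) * fact k"
    by (simp_all add: algebra_simps)
  have of_rat_fact: "(of_rat (fact k) :: real) = fact k"
    by (metis of_nat_fact of_rat_of_nat_eq)
  show "of_rat (poly ((pderiv ^^ k) (faulhaber_poly n)) 0)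
      = (-1) ^ (k + 1) * (2 ^ (k + 2) / (real (k + 1) * real (k + 2)))
        * recip_bernpoly_deriv (k + 1) n (2 * (int k + 1)) 1"
    unfolding bd poly_higher_pderiv_0 of_rat_mult faulhaber_coeff_def [symmetric] odd of_rat_fact fact
    by simp
  show "of_rat (poly ((pderiv ^^ k) (faulhaber_poly (n - 1))) 0)
      = (-1) ^ (k + 1) * (3 / real n) * (2 ^ (k + 1) / real (k + 1))
        * recip_bernpoly_deriv (k + 1) n (2 * (int k + 1)) 1"
    unfolding bd poly_higher_pderiv_0 of_rat_mult faulhaber_coeff_def [symmetric] even of_rat_fact fact
    by simp
next
  fix n k :: nat
  assume "n \<ge> 2 \<and> k \<le> faulhaber_degree n"
  then show "(-1) ^ (faulhaber_degree n - k) * faulhaber_coeff n k > 0"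
    using faulhaber_coeff_sign by blast
qed

end
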